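(* Let $m\ge1$, $\mu\in\mathbb{R}$, $C>0$, and let $p_1,p_2,\dots$ be a sequence of monic real-rooted polynomials of degree $m$, $p_i(x)=\prod_{j=1}^m(x-r_{i,j})$, such that for all $i$ \[ \frac1m\sum_j r_{i,j}=\mu \qquad\text{and}\qquad \frac1m\sum_j r_{i,j}^2<C. \] For $n\ge1$ let $q_i(x)=n^{-m}p_i(nx)$. Then \[ \lim_{n\to\infty}[\,q_1\boxplus_m q_2\boxplus_m\cdots\boxplus_m q_n\,]=(x-\mu)^m \] (coefficientwise).
   Context: For polynomials $p(x)=\sum_{i=0}^m x^{m-i}(-1)^i p_i$ and $q(x)=\sum_{i=0}^m x^{m-i}(-1)^i q_i$ of degree at most $m$, the symmetric additive convolution is \[ [p\boxplus_m q](x)=\sum_{i+j\le m} x^{m-i-j}(-1)^{i+j}\frac{(m-i)!\,(m-j)!}{(m-i-j)!\,m!}\,p_i q_j; \] this operation is associative and commutative, so iterated convolutions are well defined. Note $q_i$ depends on $n$. *)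

theory Defs
  imports "HOL-Analysis.Analysis" "HOL-Computational_Algebra.Polynomial"
begin

(* The p_i of p(x) = sum_{i<=m} x^(m-i) (-1)^i p_i, for p of degree at most m and i \<le> m. *)
definition signed_coeff :: "nat \<Rightarrow> real poly \<Rightarrow> nat \<Rightarrow> real" where
  "signed_coeff m p i = (-1) ^ i * coeff p (m - i)"

(* Meaningful for p and q of degree at most m; coefficients above degree m are ignored. *)
definition sym_add_conv :: "nat \<Rightarrow> real poly \<Rightarrow> real poly \<Rightarrow> real poly" where
  "sym_add_conv m p q =
     (\<Sum>i\<le>m. \<Sum>j\<le>m - i.
        monom ((-1) ^ (i + j) * ((fact (m - i) * fact (m - j)) / (fact (m - i - j) * fact m))
               * signed_coeff m p i * signed_coeff m q j) (m - i - j))"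

(* The convolution of q 1, ..., q n, bracketed to the left, for n \<ge> 1; the value at n = 0 is
   a dummy. *)
definition iter_sym_add_conv :: "nat \<Rightarrow> (nat \<Rightarrow> real poly) \<Rightarrow> nat \<Rightarrow> real poly" where
  "iter_sym_add_conv m q n = foldl (sym_add_conv m) (q 1) (map q [2..<Suc n])"

end

theory Submission
  imports Defs "HOL-Computational_Algebra.Polynomial_FPS"
begin

text \<open>
  Rescaling the coefficients \<open>p\<^sub>i\<close> to \<open>(m - i)! / m! \<cdot> p\<^sub>i\<close> turns the symmetric additive
  convolution into multiplication of power series modulo \<open>x\<^sup>m\<^sup>+\<^sup>1\<close>, and \<open>(x - \<mu>)\<^sup>m\<close> into
  \<open>exp (\<mu> x)\<close>. The series of \<open>q\<^sub>i\<close> agrees with \<open>exp (\<mu> x / n)\<close> up to the linear term, and the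
  remaining coefficients are \<open>O(1 / n\<^sup>2)\<close> uniformly in \<open>i\<close>, since the second moment bounds the
  roots. Replacing the \<open>n\<close> factors one at a time by \<open>exp (\<mu> x / n)\<close> costs \<open>O(1 / n)\<close> in
  the \<open>\<ell>\<^sup>1\<close> norm of the coefficients, because every partial product stays bounded.
\<close>

section \<open>A submultiplicative norm on power series truncated after degree
  \<open>m\<close>\<close>

definition trunc_norm :: "nat \<Rightarrow> real fps \<Rightarrow> real" where
  "trunc_norm m f = (\<Sum>k\<le>m. \<bar>fps_nth f k\<bar>)"

lemma trunc_norm_nonneg: "0 \<le> trunc_norm m f"
  by (simp add: trunc_norm_def sum_nonneg)

lemma trunc_norm_one [simp]: "trunc_norm m 1 = 1"
proof -
  have "trunc_norm m 1 = (\<Sum>k\<le>m. if k = 0 then 1 else 0)"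
    unfolding trunc_norm_def by (intro sum.cong) auto
  then show ?thesis by simp
qed

lemma abs_nth_le_trunc_norm: "k \<le> m \<Longrightarrow> \<bar>fps_nth f k\<bar> \<le> trunc_norm m f"
  unfolding trunc_norm_def by (rule member_le_sum) auto

lemma trunc_norm_triangle: "trunc_norm m (f + g) \<le> trunc_norm m f + trunc_norm m g"
  unfolding trunc_norm_def sum.distrib[symmetric] by (intro sum_mono) auto

lemma trunc_norm_triangle_diff: "trunc_norm m (f - g) \<le> trunc_norm m f + trunc_norm m g"
  unfolding trunc_norm_def sum.distrib[symmetric] by (intro sum_mono) auto

text \<open>The degrees up to \<open>m\<close> of a product involve only pairs with i + j \<le> m, a
  triangle inside the square over which the product of the two norms expands.\<close>

lemma trunc_norm_mult: "trunc_norm m (f * g) \<le> trunc_norm m f * trunc_norm m g"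
proof -
  let ?h = "\<lambda>i j. \<bar>fps_nth f i\<bar> * \<bar>fps_nth g j\<bar>"
  have "trunc_norm m (f * g) \<le> (\<Sum>k\<le>m. \<Sum>i\<le>k. ?h i (k - i))"
    unfolding trunc_norm_def fps_mult_nth atLeast0AtMost
    by (intro sum_mono order_trans[OF sum_abs]) (simp add: abs_mult)
  also have "\<dots> = (\<Sum>(i, j)\<in>{(i, j). i + j \<le> m}. ?h i j)"
    by (rule sum.triangle_reindex_eq[symmetric])
  also have "\<dots> \<le> (\<Sum>(i, j)\<in>{..m} \<times> {..m}. ?h i j)"
    by (rule sum_mono2) auto
  also have "\<dots> = trunc_norm m f * trunc_norm m g"
    unfolding trunc_norm_def by (simp add: sum_product sum.cartesian_product)
  finally show ?thesis .
qed

lemma trunc_norm_prod_le: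
  assumes "finite A" "\<And>i. i \<in> A \<Longrightarrow> trunc_norm m (f i) \<le> M" "0 \<le> M"
  shows "trunc_norm m (\<Prod>i\<in>A. f i) \<le> M ^ card A"
  using assms
proof (induction A rule: finite_induct)
  case (insert x A)
  have "trunc_norm m (f x * prod f A) \<le> trunc_norm m (f x) * trunc_norm m (prod f A)"
    by (rule trunc_norm_mult)
  also have "\<dots> \<le> M * M ^ card A"
    using insert by (intro mult_mono) (auto simp: trunc_norm_nonneg)
  finally show ?case using insert by simp
qed simp

text \<open>Telescoping: exchanging one factor for \<open>g\<close> costs at most
  \<open>\<delta>\<close> times the norms of the remaining factors. Since \<open>1 \<le> M\<close>,
  every such cost can be given the same power of \<open>M\<close>.\<close>

lemma trunc_norm_prod_diff_power:
  assumes "finite A" "\<And>i. i \<in> A \<Longrightarrow> trunc_norm m (f i) \<le> M" "1 \<le> M"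
    and "trunc_norm m g \<le> M" "\<And>i. i \<in> A \<Longrightarrow> trunc_norm m (f i - g) \<le> \<delta>"
  shows "trunc_norm m ((\<Prod>i\<in>A. f i) - g ^ card A) \<le> real (card A) * M ^ card A * \<delta>"
  using assms
proof (induction A rule: finite_induct)
  case (insert x A)
  let ?n = "card A"
  have \<delta>: "0 \<le> \<delta>"
    using insert.prems(4)[of x] trunc_norm_nonneg[of m "f x - g"] by simp
  have IH: "trunc_norm m (prod f A - g ^ ?n) \<le> real ?n * M ^ ?n * \<delta>"
    using insert by blast
  have "f x * prod f A - g * g ^ ?n = (f x - g) * prod f A + g * (prod f A - g ^ ?n)"
    by (simp add: algebra_simps)
  then have "trunc_norm m (f x * prod f A - g * g ^ ?n)
      \<le> trunc_norm m ((f x - g) * prod f A) + trunc_norm m (g * (prod f A - g ^ ?n))"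
    using trunc_norm_triangle by metis
  also have "trunc_norm m ((f x - g) * prod f A) \<le> \<delta> * M ^ ?n"
    using insert \<delta>
    by (intro order_trans[OF trunc_norm_mult] mult_mono trunc_norm_prod_le)
       (auto simp: trunc_norm_nonneg)
  also have "\<delta> * M ^ ?n \<le> \<delta> * M ^ Suc ?n"
    using insert.prems(2) \<delta> by (intro mult_left_mono power_increasing) auto
  also have "trunc_norm m (g * (prod f A - g ^ ?n)) \<le> M * (real ?n * M ^ ?n * \<delta>)"
    using insert.prems IH
    by (intro order_trans[OF trunc_norm_mult] mult_mono) (auto simp: trunc_norm_nonneg)
  finally show ?case
    using insert.hyps by (simp add: algebra_simps)
qed (simp add: trunc_norm_def)

text \<open>Below degree \<open>j\<close> nothing survives, and from \<open>j\<close> on each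
  coefficient shrinks by at least \<open>x ^ j\<close>. The case j = 1 will bound the norm of a
  single factor, j = 2 its distance to an exponential.\<close>

lemma trunc_norm_rescale_le:
  assumes "\<And>k. k \<le> m \<Longrightarrow> fps_nth f k = fps_nth F k / x ^ k"
    and "\<And>k. k < j \<Longrightarrow> fps_nth F k = 0" and "1 \<le> x"
  shows "trunc_norm m f \<le> trunc_norm m F / x ^ j"
  unfolding trunc_norm_def sum_divide_distrib
proof (rule sum_mono)
  fix k assume "k \<in> {..m}"
  then have k: "\<bar>fps_nth f k\<bar> = \<bar>fps_nth F k\<bar> / x ^ k"
    using assms(1,3) by simp
  show "\<bar>fps_nth f k\<bar> \<le> \<bar>fps_nth F k\<bar> / x ^ j"
  proof (cases "k < j")
    case True
    then show ?thesis using k assms(2) by simp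
  next
    case False
    then show ?thesis unfolding k using assms(3)
      by (intro divide_left_mono power_increasing mult_pos_pos) auto
  qed
qed

section \<open>Symmetric additive convolution as multiplication of power series\<close>

definition conv_fps :: "nat \<Rightarrow> real poly \<Rightarrow> real fps" where
  "conv_fps m p = Abs_fps (\<lambda>k. fact (m - k) / fact m * signed_coeff m p k)"

lemma coeff_sym_add_conv:
  "coeff (sym_add_conv m p q) l =
     (\<Sum>i\<le>m. \<Sum>j\<le>m - i. if l = m - i - j then
        (-1) ^ (i + j) * ((fact (m - i) * fact (m - j)) / (fact (m - i - j) * fact m))
               * signed_coeff m p i * signed_coeff m q j else 0)"
  unfolding sym_add_conv_def coeff_sum coeff_monom
  by (intro sum.cong refl) auto

lemma degree_sym_add_conv: "degree (sym_add_conv m p q) \<le> m"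
  by (rule degree_le) (auto simp: coeff_sym_add_conv intro!: sum.neutral)

text \<open>For i + j = k the convolution weight times (m-k)!/m! splits as (m-i)!/m! times
  (m-j)!/m!. Beyond degree \<open>m\<close> truncated subtraction makes the entries of
  \<open>conv_fps\<close> meaningless, hence \<open>k \<le> m\<close>.\<close>

lemma conv_fps_sym_add_conv:
  assumes "k \<le> m"
  shows "fps_nth (conv_fps m (sym_add_conv m p q)) k = fps_nth (conv_fps m p * conv_fps m q) k"
proof -
  define c where "c = (\<lambda>i j. (-1) ^ (i + j) *
      ((fact (m - i) * fact (m - j)) / (fact (m - i - j) * fact m))
      * signed_coeff m p i * signed_coeff m q j)"
  have inner: "(\<Sum>j\<le>m - i. if m - k = m - i - j then c i j else 0) =
          (if i \<le> k then c i (k - i) else 0)" if "i \<le> m" for i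
  proof -
    \<comment> \<open>In these ranges no subtraction truncates, so the exponents match exactly when
      i + j = k; at most one \<open>j\<close> remains.\<close>
    have "(m - k = m - i - j) = (j = k - i \<and> i \<le> k)" if "j \<le> m - i" for j
      using that \<open>i \<le> m\<close> assms by linarith
    then have "(\<Sum>j\<le>m - i. if m - k = m - i - j then c i j else 0) =
          (\<Sum>j\<le>m - i. if j = k - i then (if i \<le> k then c i j else 0) else 0)"
      by (intro sum.cong) auto
    also have "\<dots> = (if i \<le> k then c i (k - i) else 0)"
      using that assms by auto
    finally show ?thesis .
  qed
  have "coeff (sym_add_conv m p q) (m - k) = (\<Sum>i\<le>m. if i \<le> k then c i (k - i) else 0)"
    unfolding coeff_sym_add_conv c_def
    by (rule sum.cong[OF refl], rule inner[unfolded c_def], simp)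
  also have "\<dots> = (\<Sum>i\<le>k. c i (k - i))"
    using assms by (intro sum.mono_neutral_cong_right) auto
  finally have "fps_nth (conv_fps m (sym_add_conv m p q)) k =
      (\<Sum>i\<le>k. fact (m - k) / fact m * ((-1) ^ k * c i (k - i)))"
    by (simp add: conv_fps_def signed_coeff_def sum_distrib_left sum_divide_distrib)
  also have "\<dots> = (\<Sum>i\<le>k. fps_nth (conv_fps m p) i * fps_nth (conv_fps m q) (k - i))"
  proof (intro sum.cong refl)
    fix i assume "i \<in> {..k}"
    then obtain j where k: "k = i + j" using le_Suc_ex by auto
    \<comment> \<open>One sign comes from \<open>signed_coeff\<close> of the convolution, the other
      from its defining sum.\<close>
    have sign: "(-1) ^ (i + j) * ((-1) ^ (i + j) * z) = z" for z :: real
      by (cases "even (i + j)") auto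
    show "fact (m - k) / fact m * ((-1) ^ k * c i (k - i)) =
          fps_nth (conv_fps m p) i * fps_nth (conv_fps m q) (k - i)"
      unfolding k c_def mult.assoc sign by (simp add: conv_fps_def)
  qed
  finally show ?thesis by (simp add: fps_mult_nth atLeast0AtMost)
qed

lemma iter_sym_add_conv_Suc:
  "n \<ge> 1 \<Longrightarrow> iter_sym_add_conv m q (Suc n) = sym_add_conv m (iter_sym_add_conv m q n) (q (Suc n))"
  by (simp add: iter_sym_add_conv_def)

lemma conv_fps_iter_sym_add_conv:
  assumes "n \<ge> 1" "k \<le> m"
  shows "fps_nth (conv_fps m (iter_sym_add_conv m q n)) k = fps_nth (\<Prod>i=1..n. conv_fps m (q i)) k"
  using assms
proof (induction n arbitrary: k rule: dec_induct)
  case base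
  then show ?case by (simp add: iter_sym_add_conv_def)
next
  case (step n)
  have "fps_nth (conv_fps m (iter_sym_add_conv m q (Suc n))) k =
      fps_nth (conv_fps m (iter_sym_add_conv m q n) * conv_fps m (q (Suc n))) k"
    using step by (simp add: iter_sym_add_conv_Suc conv_fps_sym_add_conv)
  \<comment> \<open>A Cauchy product in degree \<open>k\<close> sees only degrees up to
    \<open>k\<close>, so agreement up to \<open>m\<close> is enough; this is why \<open>k\<close> is
    arbitrary in the induction.\<close>
  also have "\<dots> = fps_nth ((\<Prod>i=1..n. conv_fps m (q i)) * conv_fps m (q (Suc n))) k"
    unfolding fps_mult_nth using step by (intro sum.cong) auto
  finally show ?case using step by simp
qed

text \<open>The weight (m-k)!/m! reduces the binomial coefficient to 1/k!.\<close>

lemma conv_fps_linear_power: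
  assumes "k \<le> m"
  shows "fps_nth (conv_fps m ([:- \<mu>, 1:] ^ m)) k = fps_nth (fps_exp \<mu>) k"
  using assms
  by (simp add: conv_fps_def signed_coeff_def coeff_linear_poly_power binomial_fact
        field_simps flip: power_mult_distrib)

lemma coeff_eq_conv_fps:
  "k \<le> m \<Longrightarrow> coeff p k = (-1) ^ (m - k) * fact m / fact k * fps_nth (conv_fps m p) (m - k)"
  by (simp add: conv_fps_def signed_coeff_def field_simps flip: power_mult_distrib)

section \<open>Coefficient bounds in terms of the roots\<close>

lemma signed_coeff_prod_linear:
  assumes "k \<le> m"
  shows "signed_coeff m (\<Prod>j=1..m. [:- r j, 1:]) k = (-1) ^ k * coeff (\<Prod>j=1..m. [:1, - r j:]) k"
proof -
  let ?p = "\<Prod>j=1..m. [:- r j, 1:] :: real poly"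
  \<comment> \<open>\<open>signed_coeff\<close> reads coefficients from the top, so the polynomial
    is reversed factor by factor. A zero root is separate because there the reversed factor drops to
    degree 0.\<close>
  have "reflect_poly [:- c, 1:] = [:1, - c:]" for c :: real
    by (cases "c = 0") (simp_all add: reflect_poly_def)
  then have "reflect_poly ?p = (\<Prod>j=1..m. [:1, - r j:])"
    by (simp add: reflect_poly_prod)
  moreover have "degree ?p = m" by (subst degree_prod_eq_sum_degree) auto
  ultimately show ?thesis
    using assms coeff_reflect_poly[of ?p k] by (simp add: signed_coeff_def)
qed

lemma coeff_prod_one_linear:
  fixes r :: "'a \<Rightarrow> real"
  assumes "finite A"
  shows "coeff (\<Prod>j\<in>A. [:1, - r j:]) 0 = 1" "coeff (\<Prod>j\<in>A. [:1, - r j:]) 1 = - (\<Sum>j\<in>A. r j)"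
  using assms by (induction A rule: finite_induct) (auto simp: coeff_mult)

lemma trunc_norm_linear: "trunc_norm m (fps_of_poly [:1, - a:]) \<le> 1 + \<bar>a\<bar>"
proof -
  have "trunc_norm m (fps_of_poly [:1, - a:]) \<le> (\<Sum>k\<le>m. (if k = 0 then 1 else 0) + (if k = 1 then \<bar>a\<bar> else 0))"
    unfolding trunc_norm_def by (intro sum_mono) (auto simp: coeff_pCons split: nat.split)
  also have "\<dots> \<le> 1 + \<bar>a\<bar>" by (simp add: sum.distrib)
  finally show ?thesis .
qed

text \<open>The weights (m-k)!/m! are at most 1, so the reversed product dominates, and each of its
  \<open>m\<close> factors has norm at most 1 + R.\<close>

lemma trunc_norm_conv_fps_prod_linear:
  assumes "\<And>j. j \<in> {1..m} \<Longrightarrow> \<bar>r j\<bar> \<le> R" "0 \<le> R"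
  shows "trunc_norm m (conv_fps m (\<Prod>j=1..m. [:- r j, 1:])) \<le> (1 + R) ^ m"
proof -
  have "trunc_norm m (conv_fps m (\<Prod>j=1..m. [:- r j, 1:]))
      \<le> trunc_norm m (\<Prod>j=1..m. fps_of_poly [:1, - r j:])"
    unfolding trunc_norm_def
  proof (rule sum_mono)
    fix k assume "k \<in> {..m}"
    then have "\<bar>fps_nth (conv_fps m (\<Prod>j=1..m. [:- r j, 1:])) k\<bar> =
        fact (m - k) / fact m * \<bar>coeff (\<Prod>j=1..m. [:1, - r j:]) k\<bar>"
      by (simp add: conv_fps_def signed_coeff_prod_linear abs_mult power_abs del: One_nat_def)
    also have "\<dots> \<le> 1 * \<bar>coeff (\<Prod>j=1..m. [:1, - r j:]) k\<bar>"
      by (intro mult_right_mono) (auto simp: fact_mono)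
    finally show "\<bar>fps_nth (conv_fps m (\<Prod>j=1..m. [:- r j, 1:])) k\<bar>
        \<le> \<bar>fps_nth (\<Prod>j=1..m. fps_of_poly [:1, - r j:]) k\<bar>"
      by (simp flip: fps_of_poly_prod)
  qed
  also have "\<dots> \<le> (1 + R) ^ card {1..m}"
    using assms by (intro trunc_norm_prod_le order_trans[OF trunc_norm_linear]) auto
  finally show ?thesis by simp
qed

lemma conv_fps_rescale:
  assumes "n \<ge> 1" "k \<le> m"
  shows "fps_nth (conv_fps m (smult (1 / real n ^ m) (p \<circ>\<^sub>p [:0, real n:]))) k =
         fps_nth (conv_fps m p) k / real n ^ k"
proof -
  have "real n ^ m = real n ^ (m - k) * real n ^ k"
    using assms by (simp flip: power_add)
  then show ?thesis
    using assms by (simp add: conv_fps_def signed_coeff_def coeff_pcompose_linear)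
qed

section \<open>The quantitative estimate and the limit\<close>

theorem theorem6p5:
  fixes m :: nat and \<mu> C :: real
    and p :: "nat \<Rightarrow> real poly" and r :: "nat \<Rightarrow> nat \<Rightarrow> real"
    and q :: "nat \<Rightarrow> nat \<Rightarrow> real poly"
  assumes "m \<ge> 1" and "C > 0"
    and "\<And>i. i \<ge> 1 \<Longrightarrow> p i = (\<Prod>j=1..m. [:- r i j, 1:])"
    and "\<And>i. i \<ge> 1 \<Longrightarrow> (1 / real m) * (\<Sum>j=1..m. r i j) = \<mu>"
    and "\<And>i. i \<ge> 1 \<Longrightarrow> (1 / real m) * (\<Sum>j=1..m. (r i j)\<^sup>2) < C"
    and "\<And>n i. n \<ge> 1 \<Longrightarrow> i \<ge> 1 \<Longrightarrow> q n i = smult (1 / real n ^ m) (p i \<circ>\<^sub>p [:0, real n:])"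
  shows "\<forall>k. (\<lambda>n. coeff (iter_sym_add_conv m (q n) n) k)
               \<longlonglongrightarrow> coeff ([:- \<mu>, 1:] ^ m) k"
proof -
  \<comment> \<open>\<open>R\<close> bounds every root, since a single square is at most the sum of
    all squares, which is below m C.\<close>
  define R where "R = sqrt (real m * C)"
  define G where "G = fps_exp \<mu>"
  \<comment> \<open>\<open>D\<close> dominates the norms of F - 1, G - 1 and F - G at once, where F
    is the series of any \<open>p i\<close>.\<close>
  define D where "D = (1 + R) ^ m + trunc_norm m G + 1"
  have R: "0 \<le> R" using assms(2) by (simp add: R_def)
  have root_le: "\<bar>r i j\<bar> \<le> R" if "i \<ge> 1" "j \<in> {1..m}" for i j
  proof -
    have "(r i j)\<^sup>2 \<le> (\<Sum>j=1..m. (r i j)\<^sup>2)"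
      using that by (intro member_le_sum) auto
    also have "\<dots> \<le> real m * C"
      using assms(5)[OF that(1)] assms(1) by (simp add: field_simps)
    finally show ?thesis unfolding R_def by (simp add: real_le_rsqrt)
  qed
  have F_norm: "trunc_norm m (conv_fps m (p i)) \<le> (1 + R) ^ m" if "i \<ge> 1" for i
    using trunc_norm_conv_fps_prod_linear[of m "r i" R] root_le that R assms(3) by simp
  have F_0: "fps_nth (conv_fps m (p i)) 0 = 1" if "i \<ge> 1" for i
    using that assms(3) coeff_prod_one_linear(1)[of "{1..m}" "r i"]
    by (simp add: conv_fps_def signed_coeff_prod_linear del: One_nat_def)
  have F_1: "fps_nth (conv_fps m (p i)) 1 = \<mu>" if "i \<ge> 1" for i
  proof -
    \<comment> \<open>The weight (m-1)!/m! = 1/m turns the sum of the roots into their mean.\<close>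
    have "fact m = real m * fact (m - 1)" using assms(1) by (simp add: fact_reduce)
    then show ?thesis
      using that assms(1,3) assms(4)[OF that] coeff_prod_one_linear(2)[of "{1..m}" "r i"]
      by (simp add: conv_fps_def signed_coeff_prod_linear del: One_nat_def)
  qed
  have D: "0 \<le> (1 + R) ^ m" "0 \<le> trunc_norm m G" "0 \<le> D"
    using R trunc_norm_nonneg[of m G] by (auto simp: D_def)
  have bound: "trunc_norm m ((\<Prod>i=1..n. conv_fps m (q n i)) - G) \<le> D * exp D / real n"
    if n: "n \<ge> 1" for n
  proof -
    define g where "g = fps_exp (\<mu> / real n)"
    define M where "M = exp (D / real n)"
    have g_nth: "fps_nth g k = fps_nth G k / real n ^ k" for k
      by (simp add: g_def G_def power_divide)
    have f_nth: "fps_nth (conv_fps m (q n i)) k = fps_nth (conv_fps m (p i)) k / real n ^ k"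
      if "i \<ge> 1" "k \<le> m" for i k
      using that n assms(6) conv_fps_rescale by simp
    \<comment> \<open>The constant term 1 is unaffected by rescaling and the rest is at most D/n.
      Bounding 1 + D/n by its exponential keeps products of \<open>n\<close> factors below exp
      D.\<close>
    have le_M: "trunc_norm m f \<le> M"
      if "\<And>k. k \<le> m \<Longrightarrow> fps_nth f k = fps_nth F k / real n ^ k" "fps_nth F 0 = 1"
        "trunc_norm m F + 1 \<le> D" for f F
    proof -
      have "trunc_norm m (f - 1) \<le> trunc_norm m (F - 1) / real n ^ 1"
        using that n by (intro trunc_norm_rescale_le) auto
      also have "\<dots> \<le> D / real n"
        using that(3) n trunc_norm_triangle_diff[of m F 1] by (simp add: divide_right_mono)
      finally have "trunc_norm m f \<le> 1 + D / real n"
        using trunc_norm_triangle[of m "f - 1" 1] by simp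
      also have "\<dots> \<le> M" unfolding M_def by (rule exp_ge_add_one_self)
      finally show ?thesis .
    qed
    have f_le: "trunc_norm m (conv_fps m (q n i)) \<le> M" if "i \<in> {1..n}" for i
      using that f_nth F_0 F_norm[of i] D by (intro le_M[of _ "conv_fps m (p i)"]) (auto simp: D_def)
    have g_le: "trunc_norm m g \<le> M"
      using D g_nth by (intro le_M[of _ G]) (auto simp: D_def G_def)
    have diff_le: "trunc_norm m (conv_fps m (q n i) - g) \<le> D / real n ^ 2" if "i \<in> {1..n}" for i
    proof -
      have "trunc_norm m (conv_fps m (q n i) - g) \<le> trunc_norm m (conv_fps m (p i) - G) / real n ^ 2"
      proof (rule trunc_norm_rescale_le)
        \<comment> \<open>Equal means make the linear terms agree too, giving the decay 1/n^2 that
          outweighs the \<open>n\<close> replacements.\<close>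
        show "fps_nth (conv_fps m (p i) - G) k = 0" if "k < 2" for k
          using that F_0[of i] F_1[of i] \<open>i \<in> {1..n}\<close> by (auto simp: less_2_cases_iff G_def)
      qed (use that f_nth g_nth n in \<open>auto simp: diff_divide_distrib\<close>)
      also have "\<dots> \<le> D / real n ^ 2"
        using that F_norm[of i] trunc_norm_triangle_diff[of m "conv_fps m (p i)" G]
        by (intro divide_right_mono) (auto simp: D_def)
      finally show ?thesis .
    qed
    have "g ^ n = G"
      using n by (simp add: g_def G_def fps_exp_power_mult)
    then have "trunc_norm m ((\<Prod>i=1..n. conv_fps m (q n i)) - G)
        \<le> real n * M ^ n * (D / real n ^ 2)"
      using trunc_norm_prod_diff_power[of "{1..n}" m "\<lambda>i. conv_fps m (q n i)" M g "D / real n ^ 2"]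
        f_le g_le diff_le D by (simp add: M_def)
    also have "M ^ n = exp D"
      using n by (simp add: M_def flip: exp_of_nat_mult)
    finally show ?thesis using n by (simp add: field_simps power2_eq_square)
  qed
  have lim: "(\<lambda>n. fps_nth (conv_fps m (iter_sym_add_conv m (q n) n)) k) \<longlonglongrightarrow> fps_nth G k"
    if "k \<le> m" for k
  proof (rule LIM_zero_cancel, rule tendsto_rabs_zero_cancel, rule tendsto_sandwich[where f = "\<lambda>_. 0"])
    show "\<forall>\<^sub>F n in sequentially.
        \<bar>fps_nth (conv_fps m (iter_sym_add_conv m (q n) n)) k - fps_nth G k\<bar> \<le> D * exp D / real n"
      using eventually_ge_at_top[of 1]
    proof eventually_elim
      case (elim n)
      then show ?case
        using that bound[of n]
          abs_nth_le_trunc_norm[of k m "(\<Prod>i=1..n. conv_fps m (q n i)) - G"]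
        by (simp add: conv_fps_iter_sym_add_conv)
    qed
    show "(\<lambda>n. D * exp D / real n) \<longlonglongrightarrow> 0" by (rule lim_const_over_n)
  qed auto
  show ?thesis
  proof
    fix k
    show "(\<lambda>n. coeff (iter_sym_add_conv m (q n) n) k) \<longlonglongrightarrow> coeff ([:- \<mu>, 1:] ^ m) k"
    proof (cases "k \<le> m")
      case True
      then have "(\<lambda>n. (-1) ^ (m - k) * fact m / fact k *
            fps_nth (conv_fps m (iter_sym_add_conv m (q n) n)) (m - k))
          \<longlonglongrightarrow> (-1) ^ (m - k) * fact m / fact k * fps_nth G (m - k)"
        by (intro tendsto_mult_left lim) simp
      then show ?thesis
        using True by (simp add: coeff_eq_conv_fps[of k m] conv_fps_linear_power G_def
            del: fps_exp_nth)
    next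
      case False
      \<comment> \<open>From n = 2 on the outermost operation is a convolution, whose degree is at
        most \<open>m\<close> whatever its arguments.\<close>
      have "coeff (iter_sym_add_conv m (q n) n) k = 0" if "n \<ge> 2" for n
      proof -
        obtain l where "n = Suc l" "l \<ge> 1" using \<open>n \<ge> 2\<close> by (cases n) auto
        then show ?thesis
          using False degree_sym_add_conv le_less_trans not_le
          by (metis coeff_eq_0 iter_sym_add_conv_Suc)
      qed
      then have "\<forall>\<^sub>F n in sequentially. coeff (iter_sym_add_conv m (q n) n) k = 0"
        by (intro eventually_sequentiallyI[of 2]) simp
      moreover have "coeff ([:- \<mu>, 1:] ^ m) k = 0"
        using False by (intro coeff_eq_0) (simp add: degree_power_eq)
      ultimately show ?thesis
        by (simp add: tendsto_eventually)
    qed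
  qed
qed

end
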